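(* Suppose that the chromatic number of the distance one graph $G(\mathbb{R}^2,\{1\})$ is strictly greater than $4$. Then every four point subset of $\mathbb{R}^2$ is Jackson in $\mathbb{R}^2$.
   Context: The distance one graph $G(\mathbb{R}^2,\{1\})$ has vertex set $\mathbb{R}^2$, with two points adjacent iff their Euclidean distance is exactly $1$. The chromatic number of a graph is the smallest $k$ such that its vertices can be partitioned into $k$ sets none of which contains two adjacent vertices. An isometric copy of $X\subseteq\mathbb{R}^2$ is the image of $X$ under an isometry of $\mathbb{R}^2$. A set $X\subseteq\mathbb{R}^2$ is Jackson in $\mathbb{R}^2$ if for every $S\subseteq\mathbb{R}^2$ there is an isometric copy $Y$ of $X$ in $\mathbb{R}^2$ with $|Y\cap S|\neq 1$. *)

theory Defs
  imports "HOL-Analysis.Analysis" "HOL-Library.Disjoint_Sets" "HOL-Library.Extended_Nat"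
begin

text \<open>A graph is a pair of a (possibly infinite) vertex set and a set of edges, an edge being the
  two-element set of its endpoints.\<close>

type_synonym 'a graph = "'a set \<times> 'a set set"

definition adjacent :: "'a graph \<Rightarrow> 'a \<Rightarrow> 'a \<Rightarrow> bool" where
  "adjacent G u v \<longleftrightarrow> {u, v} \<in> snd G"

definition distance_graph :: "'a::metric_space set \<Rightarrow> real set \<Rightarrow> 'a graph" where
  "distance_graph X D = (X, {{x, y} | x y. x \<in> X \<and> y \<in> X \<and> x \<noteq> y \<and> dist x y \<in> D})"

definition colour_partition :: "'a graph \<Rightarrow> nat \<Rightarrow> 'a set set \<Rightarrow> bool" where
  "colour_partition G k P \<longleftrightarrow>
     partition_on (fst G) P \<and> finite P \<and> card P = k \<and>
     (\<forall>C\<in>P. \<forall>u\<in>C. \<forall>v\<in>C. \<not> adjacent G u v)"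

text \<open>Infima of nonempty sets of extended naturals are minima; the value is infinite precisely
  when no finite partition into independent sets exists.\<close>

definition chromatic_number :: "'a graph \<Rightarrow> enat" where
  "chromatic_number G = (INF k \<in> {k. \<exists>P. colour_partition G k P}. enat k)"

text \<open>Surjectivity is automatic for distance-preserving self-maps of Euclidean space, but not in
  general metric spaces.\<close>

definition isometry :: "('a::metric_space \<Rightarrow> 'a) \<Rightarrow> bool" where
  "isometry f \<longleftrightarrow> surj f \<and> (\<forall>x y. dist (f x) (f y) = dist x y)"

definition isometric_copy :: "'a::metric_space set \<Rightarrow> 'a set \<Rightarrow> bool" where
  "isometric_copy X Y \<longleftrightarrow> (\<exists>f. isometry f \<and> Y = f ` X)"

text \<open>The library's \<^const>\<open>card\<close> is 0 on infinite sets, so the inequation below is also correct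
  when the intersection is infinite.\<close>

definition Jackson :: "'a::metric_space set \<Rightarrow> bool" where
  "Jackson X \<longleftrightarrow> (\<forall>S. \<exists>Y. isometric_copy X Y \<and> card (Y \<inter> S) \<noteq> 1)"

end

theory Submission
  imports Defs
begin

text \<open>Suppose that \<open>X\<close> is not Jackson, so that some set \<open>S\<close> meets every isometric copy of \<open>X\<close> in
  exactly one point. Let \<open>r > 0\<close> be the distance of two points of \<open>X\<close>. Any two points at distance
  \<open>r\<close> lie together in a copy of \<open>X\<close>, so \<open>S\<close> contains no such pair
  (\<open>singleton_intersections_avoid_distances\<close>). On the other hand, translates of \<open>X\<close> are copies: for
  each \<open>p\<close> there is exactly one \<open>x \<in> X\<close> with \<open>p + x \<in> S\<close>. Colouring \<open>p\<close> with this \<open>x\<close> partitions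
  the space into at most \<open>card X\<close> translates of \<open>S\<close>, each of which avoids the distance \<open>r\<close>.
  Rescaling turns \<open>r\<close> into \<open>1\<close>, hence the distance one graph has chromatic number at most
  \<open>card X\<close>. The same argument covers every finite set of at least two points in any
  dimension, as stated in \<open>chromatic_number_le_card_if_not_Jackson\<close>; the plane and
  \<open>card X = 4\<close> give the claim.\<close>

lemma chromatic_number_le_card_colours:
  assumes "finite A" and "c ` fst G \<subseteq> A"
    and proper: "\<And>u v. u \<in> fst G \<Longrightarrow> v \<in> fst G \<Longrightarrow> adjacent G u v \<Longrightarrow> c u \<noteq> c v"
  shows "chromatic_number G \<le> enat (card A)"
proof -
  \<comment> \<open>Only colours in the range of \<open>c\<close> are used, since the blocks of a partition are nonempty.\<close>
  define P where "P = (\<lambda>x. {v \<in> fst G. c v = x}) ` (c ` fst G)"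
  have fin: "finite (c ` fst G)"
    using assms(1,2) finite_subset by blast
  have "partition_on (fst G) P"
    by (rule partition_onI) (auto simp: P_def disjnt_def)
  moreover have "\<not> adjacent G u v" if "C \<in> P" "u \<in> C" "v \<in> C" for C u v
    using that proper[of u v] by (auto simp: P_def)
  ultimately have "colour_partition G (card P) P"
    using fin by (auto simp: colour_partition_def P_def)
  then have "chromatic_number G \<le> enat (card P)"
    unfolding chromatic_number_def by (intro INF_lower) blast
  also have "card P \<le> card A"
    unfolding P_def using card_image_le[OF fin] card_mono[OF assms(1,2)] le_trans by blast
  finally show ?thesis by simp
qed

text \<open>A rotation or reflection aligns the two difference vectors, and a translation then
  moves \<open>a\<close> to \<open>p\<close>.\<close>

lemma isometry_moves_pair:
  fixes a b p q :: "real ^ 'n"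
  assumes "dist a b = dist p q"
  obtains f where "isometry f" and "f a = p" and "f b = q"
proof -
  have "norm (b - a) = norm (q - p)"
    using assms by (simp add: dist_norm norm_minus_commute)
  then obtain g where g: "orthogonal_transformation g" "g (b - a) = q - p"
    by (rule orthogonal_transformation_exists)
  then have lin: "linear g" and "surj g"
    by (auto simp: orthogonal_transformation_linear orthogonal_transformation_surj)
  define f where "f x = p + g (x - a)" for x
  have "isometry f"
    unfolding isometry_def
  proof (intro conjI allI)
    show "surj f"
    proof (rule surjI)
      fix y
      show "f (a + inv g (y - p)) = y"
        using \<open>surj g\<close> by (simp add: f_def surj_f_inv_f)
    qed
    show "dist (f x) (f y) = dist x y" for x y
      using g(1) by (simp add: f_def orthogonal_transformation_isometry) (simp add: dist_norm)
  qed
  moreover have "f a = p" and "f b = q"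
    using g(2) linear_0[OF lin] by (simp_all add: f_def)
  ultimately show thesis by (rule that)
qed

text \<open>If \<open>p\<close> and \<open>q\<close> had the distance of \<open>a\<close> and \<open>b\<close>, the copy of \<open>X\<close> that carries \<open>a, b\<close> to
  \<open>p, q\<close> would meet \<open>S\<close> in two points.\<close>

lemma singleton_intersections_avoid_distances:
  fixes X S :: "(real ^ 'n) set"
  assumes unit: "\<And>Y. isometric_copy X Y \<Longrightarrow> card (Y \<inter> S) = 1"
    and "a \<in> X" "b \<in> X" "a \<noteq> b" and "p \<in> S" "q \<in> S"
  shows "dist p q \<noteq> dist a b"
proof
  assume "dist p q = dist a b"
  then obtain f where f: "isometry f" "f a = p" "f b = q"
    using isometry_moves_pair by metis
  have "card (f ` X \<inter> S) = 1"
    using unit f(1) by (auto simp: isometric_copy_def)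
  moreover have "p \<in> f ` X \<inter> S" and "q \<in> f ` X \<inter> S"
    using f assms by auto
  ultimately have "p = q"
    by (metis card_1_singletonE singletonD)
  then show False
    using \<open>dist p q = dist a b\<close> \<open>a \<noteq> b\<close> by simp
qed

lemma isometric_copy_translation:
  fixes X :: "'a::real_normed_vector set"
  shows "isometric_copy X ((+) t ` X)"
  unfolding isometric_copy_def isometry_def by (intro exI[of _ "(+) t"]) auto

theorem chromatic_number_le_card_if_not_Jackson:
  fixes X :: "(real ^ 'n) set"
  assumes "card X \<ge> 2" and "\<not> Jackson X"
  shows "chromatic_number (distance_graph (UNIV :: (real ^ 'n) set) {1}) \<le> enat (card X)"
proof -
  obtain S where unit: "\<And>Y. isometric_copy X Y \<Longrightarrow> card (Y \<inter> S) = 1"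
    using assms(2) unfolding Jackson_def by blast
  have "finite X"
    using assms(1) card.infinite by fastforce
  obtain a b where ab: "a \<in> X" "b \<in> X" "a \<noteq> b"
    using assms(1) by (metis card_2_iff' obtain_subset_with_card_n subsetD)
  define r where "r = dist a b"
  have "r > 0"
    using ab by (simp add: r_def)
  \<comment> \<open>The point is scaled by \<open>r\<close> so that unit distances become the distance avoided by \<open>S\<close>.\<close>
  have "\<forall>p. \<exists>x. x \<in> X \<and> r *\<^sub>R p + x \<in> S"
  proof
    fix p
    have "(+) (r *\<^sub>R p) ` X \<inter> S \<noteq> {}"
      using unit[OF isometric_copy_translation, of "r *\<^sub>R p"] by auto
    then show "\<exists>x. x \<in> X \<and> r *\<^sub>R p + x \<in> S" by auto
  qed
  then obtain c where c: "\<And>p. c p \<in> X" "\<And>p. r *\<^sub>R p + c p \<in> S"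
    using choice[of "\<lambda>p x. x \<in> X \<and> r *\<^sub>R p + x \<in> S"] by blast
  show ?thesis
  proof (rule chromatic_number_le_card_colours[OF \<open>finite X\<close>, of c])
    show "c ` fst (distance_graph UNIV {1}) \<subseteq> X"
      using c(1) by auto
    fix u v :: "real ^ 'n"
    assume "adjacent (distance_graph UNIV {1}) u v"
    then have "dist u v = 1"
      by (auto simp: adjacent_def distance_graph_def doubleton_eq_iff dist_commute)
    moreover have "dist (r *\<^sub>R u + x) (r *\<^sub>R v + x) = r * dist u v" for x
      using \<open>r > 0\<close> by (simp add: dist_norm flip: scaleR_diff_right)
    ultimately have "dist (r *\<^sub>R u + x) (r *\<^sub>R v + x) = r" for x
      by simp
    then show "c u \<noteq> c v"
      using singleton_intersections_avoid_distances[OF unit ab c(2)[of u] c(2)[of v]]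
      by (auto simp: r_def)
  qed
qed

theorem proposition1p4:
  assumes "chromatic_number (distance_graph (UNIV :: (real ^ 2) set) {1}) > 4"
  shows "\<forall>X :: (real ^ 2) set. card X = 4 \<longrightarrow> Jackson X"
proof (intro allI impI)
  fix X :: "(real ^ 2) set"
  assume "card X = 4"
  then show "Jackson X"
    using assms chromatic_number_le_card_if_not_Jackson[of X]
    by (auto simp: numeral_eq_enat not_le[symmetric])
qed

end
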